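(* For every integer $n \ge 1$, let $f(n)$ be the maximum, over all cyclic permutations $\pi$ of order $n$, of the minimum number of adjacent swaps needed to transform $\pi$ into the trivial cyclic permutation $u=(1,2,\ldots,n)$. Then \[ f(n) \le \left\lfloor \frac{(n-1)^2}{4} \right\rfloor. \]
   Context: A cyclic permutation of order $n$ is a bijective labeling of the vertices of a cycle of length $n$ by the elements of $[n]=\{1,\ldots,n\}$, where two labelings that differ by a rotation of the cycle (a cyclic shift) are considered the same; reflections are not identified. An adjacent swap transforms a cyclic permutation into the one obtained by exchanging the labels of two vertices that are adjacent along the cycle. The trivial cyclic permutation $u=(1,2,\ldots,n)$ is the labeling in which the labels $1,2,\ldots,n$ appear consecutively around the cycle in this order. *)

theory Defs
  imports Complex_Main "HOL-Combinatorics.Combinatorics"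
begin

text \<open>
  The vertices of the cycle of length \<open>n\<close> are the positions \<open>0, \<dots>, n - 1\<close>, taken modulo \<open>n\<close>, so a
  bijective labeling by \<open>[n]\<close> is a list in \<open>permutations_of_set {1..n}\<close>.
\<close>

definition rotation_rel :: "nat \<Rightarrow> (nat list \<times> nat list) set" where
  "rotation_rel n =
     {(xs, ys). xs \<in> permutations_of_set {1..n} \<and> ys \<in> permutations_of_set {1..n} \<and>
                (\<exists>k. ys = rotate k xs)}"

definition cyclic_class :: "nat \<Rightarrow> nat list \<Rightarrow> nat list set" where
  "cyclic_class n xs = rotation_rel n `` {xs}"

definition cyclic_perms :: "nat \<Rightarrow> nat list set set" where
  "cyclic_perms n = permutations_of_set {1..n} // rotation_rel n"

definition trivial_cyclic_perm :: "nat \<Rightarrow> nat list set" where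
  "trivial_cyclic_perm n = cyclic_class n [1..<Suc n]"

definition cycle_adjacent :: "nat \<Rightarrow> nat \<Rightarrow> nat \<Rightarrow> bool" where
  "cycle_adjacent n i j \<longleftrightarrow>
     i < n \<and> j < n \<and> i \<noteq> j \<and> (j = Suc i mod n \<or> i = Suc j mod n)"

definition swap_labels :: "nat \<Rightarrow> nat \<Rightarrow> nat list \<Rightarrow> nat list" where
  "swap_labels i j xs = xs[i := xs ! j, j := xs ! i]"

definition adjacent_swap :: "nat \<Rightarrow> nat list set \<Rightarrow> nat list set \<Rightarrow> bool" where
  "adjacent_swap n \<pi> \<sigma> \<longleftrightarrow>
     \<pi> \<in> cyclic_perms n \<and>
     (\<exists>xs\<in>\<pi>. \<exists>i j. cycle_adjacent n i j \<and> \<sigma> = cyclic_class n (swap_labels i j xs))"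

definition swap_distance :: "nat \<Rightarrow> nat list set \<Rightarrow> nat list set \<Rightarrow> nat" where
  "swap_distance n \<pi> \<sigma> = (LEAST k. (adjacent_swap n ^^ k) \<pi> \<sigma>)"

definition max_swap_distance :: "nat \<Rightarrow> nat" where
  "max_swap_distance n =
     Max ((\<lambda>\<pi>. swap_distance n \<pi> (trivial_cyclic_perm n)) ` cyclic_perms n)"

text \<open>
  The remaining facts show that the minimum and the maximum above are taken over nonempty sets,
  the latter finite, so that \<open>LEAST\<close> and \<open>Max\<close> have their intended meaning.
\<close>

lemma equiv_rotation_rel: "equiv (permutations_of_set {1..n}) (rotation_rel n)"
proof (rule equivI)
  show "rotation_rel n \<subseteq> permutations_of_set {1..n} \<times> permutations_of_set {1..n}"
    by (auto simp: rotation_rel_def)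
  show "refl_on (permutations_of_set {1..n}) (rotation_rel n)"
    by (auto simp: refl_on_def rotation_rel_def intro: exI[of _ 0])
  show "sym (rotation_rel n)"
  proof (rule symI)
    fix xs ys assume *: "(xs, ys) \<in> rotation_rel n"
    then obtain k where k: "ys = rotate k xs" by (auto simp: rotation_rel_def)
    have "rotate (length xs - k mod length xs) (rotate (k mod length xs) xs) = xs"
    proof (cases "xs = []")
      case False
      then have "length xs - k mod length xs + k mod length xs = length xs"
        by (simp add: less_imp_le)
      then show ?thesis by (simp add: rotate_rotate)
    qed simp
    then have "xs = rotate (length xs - k mod length xs) ys"
      by (metis k rotate_conv_mod)
    then show "(ys, xs) \<in> rotation_rel n" using * by (auto simp: rotation_rel_def)
  qed
  show "trans (rotation_rel n)"
    by (rule transI) (auto simp: rotation_rel_def rotate_rotate)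
qed

lemma finite_cyclic_perms: "finite (cyclic_perms n)"
  unfolding cyclic_perms_def
  by (rule finite_quotient) (auto simp: rotation_rel_def)

lemma cyclic_class_in_cyclic_perms:
  "xs \<in> permutations_of_set {1..n} \<Longrightarrow> cyclic_class n xs \<in> cyclic_perms n"
  by (simp add: cyclic_class_def cyclic_perms_def quotientI)

lemma self_in_cyclic_class:
  "xs \<in> permutations_of_set {1..n} \<Longrightarrow> xs \<in> cyclic_class n xs"
  using equiv_class_self[OF equiv_rotation_rel] by (simp add: cyclic_class_def)

lemma upt_in_permutations_of_set: "[1..<Suc n] \<in> permutations_of_set {1..n}"
  by (auto simp: permutations_of_set_def)

lemma trivial_cyclic_perm_in_cyclic_perms: "trivial_cyclic_perm n \<in> cyclic_perms n"
  unfolding trivial_cyclic_perm_def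
  by (intro cyclic_class_in_cyclic_perms upt_in_permutations_of_set)

lemma adjacent_swaps_move_to_front:
  assumes "u @ a @ y # b \<in> permutations_of_set {1..n}"
  shows "(adjacent_swap n)\<^sup>*\<^sup>* (cyclic_class n (u @ a @ y # b)) (cyclic_class n (u @ y # a @ b))"
  using assms
proof (induction a arbitrary: b rule: rev_induct)
  case (snoc x a)
  let ?xs = "u @ a @ x # y # b" and ?ys = "u @ a @ y # x # b"
  let ?i = "length u + length a"
  have xs: "?xs \<in> permutations_of_set {1..n}" using snoc.prems by simp
  then have ys: "?ys \<in> permutations_of_set {1..n}" by (auto simp: permutations_of_set_def)
  have len: "length ?xs = n" using length_finite_permutations_of_set[OF xs] by simp
  then have "cycle_adjacent n ?i (Suc ?i)" by (auto simp: cycle_adjacent_def)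
  moreover have "swap_labels ?i (Suc ?i) ?xs = ?ys"
    by (simp add: swap_labels_def nth_append list_update_append)
  ultimately have "adjacent_swap n (cyclic_class n ?xs) (cyclic_class n ?ys)"
    unfolding adjacent_swap_def
    using cyclic_class_in_cyclic_perms[OF xs] self_in_cyclic_class[OF xs] by metis
  then show ?case using snoc.IH[OF ys] by simp
qed simp

lemma adjacent_swaps_connect:
  assumes "u @ xs \<in> permutations_of_set {1..n}" and "mset xs = mset ys"
  shows "(adjacent_swap n)\<^sup>*\<^sup>* (cyclic_class n (u @ xs)) (cyclic_class n (u @ ys))"
  using assms
proof (induction ys arbitrary: u xs)
  case (Cons y ys)
  then have "y \<in> set xs" by (metis list.set_intros(1) mset_eq_setD)
  then obtain a b where ab: "xs = a @ y # b" by (meson split_list)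
  then have m: "mset (a @ b) = mset ys" using Cons.prems(2) by simp
  have "(u @ [y]) @ a @ b \<in> permutations_of_set {1..n}"
    using Cons.prems(1) ab by (auto simp: permutations_of_set_def)
  from Cons.IH[OF this m] adjacent_swaps_move_to_front[of u a y b n] Cons.prems(1) ab
  show ?case by auto
qed simp

lemma trivial_cyclic_perm_reachable:
  assumes "\<pi> \<in> cyclic_perms n"
  shows "\<exists>k. (adjacent_swap n ^^ k) \<pi> (trivial_cyclic_perm n)"
proof -
  from assms obtain xs where xs: "xs \<in> permutations_of_set {1..n}" "\<pi> = cyclic_class n xs"
    by (auto simp: cyclic_perms_def cyclic_class_def elim!: quotientE)
  have "mset xs = mset [1..<Suc n]"
    using xs(1) upt_in_permutations_of_set[of n]
    by (intro set_eq_iff_mset_eq_distinct[THEN iffD1]) (auto simp: permutations_of_set_def)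
  then have "(adjacent_swap n)\<^sup>*\<^sup>* \<pi> (trivial_cyclic_perm n)"
    using adjacent_swaps_connect[of "[]" xs n "[1..<Suc n]"] xs
    by (simp add: trivial_cyclic_perm_def)
  then show ?thesis by (rule rtranclp_imp_relpowp)
qed

end

theory Submission
  imports Defs
begin

text \<open>
  Lift the labels to integers, one per position, with distinct residues modulo \<open>n\<close>, and extend
  periodically to an affine permutation. A lift \<open>w\<close> can be sorted with
  \<open>\<Sum>\<^sub>p\<^sub><\<^sub>q \<bar>\<lfloor>(w\<^sub>q - w\<^sub>p) / n\<rfloor>\<bar>\<close> adjacent swaps (Shi's formula for the affine length).

  For each \<open>t < n\<close>, take the lift that moves every label by at least \<open>-t\<close> and less than \<open>n - t\<close>
  steps. For two labels at cyclic distance \<open>e\<close> in the given permutation and \<open>d\<close> in the trivial one,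
  the \<open>n\<close> terms \<open>\<lfloor>(w\<^sub>q - w\<^sub>p) / n\<rfloor>\<close> have the same sign and, by Hermite's identity, sum to
  \<open>e - d\<close>.
  Now \<open>\<bar>e - d\<bar> \<le> \<bar>e - n/2\<bar> + \<bar>d - n/2\<bar>\<close>, and the right-hand side summed over all pairs does not
  depend on the permutation and is at most \<open>n (n - 1)\<^sup>2 / 4\<close>. Hence one of the \<open>n\<close> lifts has length
  at most \<open>(n - 1)\<^sup>2 / 4\<close>.
\<close>

section \<open>Swap distances\<close>

lemma cyclic_class_rotate:
  assumes "xs \<in> permutations_of_set {1..n}"
  shows "cyclic_class n (rotate k xs) = cyclic_class n xs"
proof -
  have "rotate k xs \<in> permutations_of_set {1..n}"
    using assms by (auto simp: permutations_of_set_def)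
  then have "(xs, rotate k xs) \<in> rotation_rel n"
    using assms by (auto simp: rotation_rel_def)
  then show ?thesis
    unfolding cyclic_class_def using equiv_class_eq[OF equiv_rotation_rel] by metis
qed

lemma adjacent_swap_append:
  assumes "u @ x # y # v \<in> permutations_of_set {1..n}"
  shows "adjacent_swap n (cyclic_class n (u @ x # y # v)) (cyclic_class n (u @ y # x # v))"
proof -
  let ?xs = "u @ x # y # v" and ?i = "length u"
  have "length ?xs = n"
    using length_finite_permutations_of_set[OF assms] by simp
  then have "cycle_adjacent n ?i (Suc ?i)"
    by (auto simp: cycle_adjacent_def)
  moreover have "swap_labels ?i (Suc ?i) ?xs = u @ y # x # v"
    by (simp add: swap_labels_def nth_append list_update_append)
  ultimately show ?thesis
    unfolding adjacent_swap_def
    using cyclic_class_in_cyclic_perms[OF assms] self_in_cyclic_class[OF assms] by metis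
qed

lemma swap_distance_self: "swap_distance n \<pi> \<pi> = 0"
  by (simp add: swap_distance_def)

lemma swap_distance_le_Suc:
  assumes "adjacent_swap n \<pi> \<sigma>" and "\<exists>k. (adjacent_swap n ^^ k) \<sigma> \<tau>"
  shows "swap_distance n \<pi> \<tau> \<le> Suc (swap_distance n \<sigma> \<tau>)"
proof -
  have "(adjacent_swap n ^^ swap_distance n \<sigma> \<tau>) \<sigma> \<tau>"
    unfolding swap_distance_def using assms(2) by (rule LeastI_ex)
  with assms(1) have "(adjacent_swap n ^^ Suc (swap_distance n \<sigma> \<tau>)) \<pi> \<tau>"
    by (rule relpowp_Suc_I2)
  then show ?thesis
    unfolding swap_distance_def[of n \<pi>] by (rule Least_le)
qed

section \<open>Sorting a lift\<close>

fun affine_length :: "int \<Rightarrow> int list \<Rightarrow> int" where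
  "affine_length N [] = 0"
| "affine_length N (x # xs) = (\<Sum>y\<leftarrow>xs. \<bar>(y - x) div N\<bar>) + affine_length N xs"

lemma affine_length_nonneg: "0 \<le> affine_length N xs"
  by (induction xs) (auto intro!: add_nonneg_nonneg sum_list_nonneg)

lemma affine_length_snoc:
  "affine_length N (xs @ [y]) = affine_length N xs + (\<Sum>x\<leftarrow>xs. \<bar>(y - x) div N\<bar>)"
  by (induction xs) auto

lemma affine_length_map_upt:
  "affine_length N (map v [0..<n]) = (\<Sum>q<n. \<Sum>p<q. \<bar>(v q - v p) div N\<bar>)"
proof (induction n)
  case (Suc n)
  have "(\<Sum>x\<leftarrow>map v [0..<n]. \<bar>(v n - x) div N\<bar>) = (\<Sum>p<n. \<bar>(v n - v p) div N\<bar>)"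
    by (simp add: comp_def interv_sum_list_conv_sum_set_nat atLeast0LessThan)
  with Suc show ?case by (simp add: affine_length_snoc)
qed simp

lemma affine_length_rotate:
  assumes "N \<noteq> 0" and "\<And>y. y \<in> set xs \<Longrightarrow> \<not> N dvd y - x"
  shows "affine_length N (xs @ [x + N]) = affine_length N (x # xs)"
proof -
  have "\<bar>(x + N - y) div N\<bar> = \<bar>(y - x) div N\<bar>" if "y \<in> set xs" for y
  proof -
    have "(x + N - y) div N = (- (y - x)) div N + 1"
      using div_add_self2[of N "- (y - x)"] assms(1) by (simp add: algebra_simps)
    also have "\<dots> = - ((y - x) div N)"
      using zdiv_zminus1_eq_if[of N "y - x"] assms(1) assms(2)[OF that]
      by (simp add: mod_eq_0_iff_dvd)
    finally show ?thesis by simp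
  qed
  then show ?thesis by (simp add: affine_length_snoc cong: map_cong)
qed

lemma affine_length_swap_descent:
  assumes "N > 0" and "\<not> N dvd x - y" and "y < x"
  shows "affine_length N (u @ x # y # v) = affine_length N (u @ y # x # v) + 1"
proof (induction u)
  case Nil
  have "(y - x) div N = - ((x - y) div N) - 1"
    using zdiv_zminus1_eq_if[of N "x - y"] assms by (simp add: mod_eq_0_iff_dvd)
  moreover have "(x - y) div N \<ge> 0"
    using assms by (simp add: pos_imp_zdiv_nonneg_iff)
  ultimately show ?case by simp
qed simp

text \<open>The residue \<open>r \<in> {0, \<dots>, n - 1}\<close> stands for the label \<open>r + 1\<close>.\<close>

definition window_labels :: "nat \<Rightarrow> int list \<Rightarrow> nat list" where
  "window_labels n ws = map (\<lambda>w. Suc (nat (w mod int n))) ws"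

abbreviation affine_window :: "nat \<Rightarrow> int list \<Rightarrow> bool" where
  "affine_window n ws \<equiv> window_labels n ws \<in> permutations_of_set {1..n}"

abbreviation window_class :: "nat \<Rightarrow> int list \<Rightarrow> nat list set" where
  "window_class n ws \<equiv> cyclic_class n (window_labels n ws)"

lemma window_labels_simps [simp]:
  "window_labels n [] = []"
  "window_labels n (w # ws) = Suc (nat (w mod int n)) # window_labels n ws"
  "window_labels n (us @ ws) = window_labels n us @ window_labels n ws"
  by (simp_all add: window_labels_def)

lemma not_dvd_diff_window:
  assumes "distinct (window_labels n (u @ x # v))" and "y \<in> set u \<union> set v"
  shows "\<not> int n dvd y - x"
proof -
  have "Suc (nat (y mod int n)) \<in> set (window_labels n u) \<union> set (window_labels n v)"
    using assms(2) by (auto simp: window_labels_def)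
  with assms(1) have "y mod int n \<noteq> x mod int n" by auto
  then show ?thesis by (simp add: mod_eq_dvd_iff)
qed

lemma window_labels_rotate:
  "window_labels n (ws @ [w + int n]) = rotate1 (window_labels n (w # ws))"
  by simp

lemma affine_length_window_rotate:
  assumes window: "affine_window n (w # ws)"
  shows "affine_length (int n) (ws @ [w + int n]) = affine_length (int n) (w # ws)"
proof (rule affine_length_rotate)
  show "int n \<noteq> 0"
    using length_finite_permutations_of_set[OF window] by simp
  show "\<not> int n dvd y - w" if "y \<in> set ws" for y
    using not_dvd_diff_window[of n "[]" w ws y] permutations_of_setD(2)[OF window] that by simp
qed

lemma affine_length_window_swap_descent:
  assumes window: "affine_window n (u @ x # y # v)" and "y < x"
  shows "affine_length (int n) (u @ x # y # v) = affine_length (int n) (u @ y # x # v) + 1"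
proof (rule affine_length_swap_descent)
  show "int n > 0"
    using length_finite_permutations_of_set[OF window] by simp
  show "\<not> int n dvd x - y"
    using not_dvd_diff_window[of n "u @ [x]" y v x] permutations_of_setD(2)[OF window] by simp
qed fact

lemma window_labels_upto:
  "window_labels n [a..a + int n - 1] = rotate (nat (a mod int n)) [1..<Suc n]"
proof (rule nth_equalityI)
  fix i assume "i < length (window_labels n [a..a + int n - 1])"
  then have "i < n" by (simp add: window_labels_def)
  have "int ((nat (a mod int n) + i) mod n) = (a + int i) mod int n"
    using \<open>i < n\<close> by (simp add: zmod_int mod_simps)
  then have "nat ((a + int i) mod int n) = (nat (a mod int n) + i) mod n"
    by (metis nat_int)
  with \<open>i < n\<close> show "window_labels n [a..a + int n - 1] ! i =
      rotate (nat (a mod int n)) [1..<Suc n] ! i"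
    by (simp add: window_labels_def nth_rotate del: upt_Suc)
qed (simp add: window_labels_def)

lemma sorted_distinct_eq_upto:
  assumes "sorted ws" and "distinct ws" and "set ws \<subseteq> {a..<a + int (length ws)}"
  shows "ws = [a..a + int (length ws) - 1]"
proof -
  have "set ws = set [a..a + int (length ws) - 1]"
  proof (rule card_subset_eq)
    show "set ws \<subseteq> set [a..a + int (length ws) - 1]" using assms(3) by auto
    show "card (set ws) = card (set [a..a + int (length ws) - 1])"
      using assms(2) by (simp add: distinct_card)
  qed simp
  then show ?thesis
    by (rule sorted_distinct_set_unique[OF assms(1,2) sorted_upto distinct_upto])
qed

lemma window_class_sorted:
  assumes window: "affine_window n ws"
    and "sorted ws" and "set ws \<subseteq> {a..<a + int n}"
  shows "window_class n ws = trivial_cyclic_perm n"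
proof -
  have "distinct ws" and "length ws = n"
    using permutations_of_setD[OF window] length_finite_permutations_of_set[OF window]
    by (auto simp: window_labels_def distinct_map)
  then have "ws = [a..a + int n - 1]"
    using assms sorted_distinct_eq_upto by blast
  then show ?thesis
    unfolding trivial_cyclic_perm_def
    by (metis window_labels_upto cyclic_class_rotate[OF upt_in_permutations_of_set])
qed

lemma not_sorted_descent:
  assumes "\<not> sorted ws"
  obtains u x y v where "ws = u @ x # y # v" and "y < x"
proof -
  from assms obtain i where i: "Suc i < length ws" "ws ! Suc i < ws ! i"
    by (auto simp: sorted_iff_nth_Suc not_le)
  then have "ws = take i ws @ ws ! i # ws ! Suc i # drop (Suc (Suc i)) ws"
    by (metis Cons_nth_drop_Suc Suc_lessD append_take_drop_id)
  with i(2) show ?thesis by (rule that[rotated])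
qed

lemma sorted_window_span:
  assumes window: "affine_window n (w # zs)" and sorted: "sorted (w # zs)"
    and nontrivial: "window_class n (w # zs) \<noteq> trivial_cyclic_perm n"
  obtains u y where "zs = u @ [y]" and "w + int n < y"
proof -
  have "n > 0"
    using length_finite_permutations_of_set[OF window] by simp
  have "\<not> set (w # zs) \<subseteq> {w..<w + int n}"
    using window_class_sorted window sorted nontrivial by blast
  then obtain z where "z \<in> set (w # zs)" and "z \<notin> {w..<w + int n}" by blast
  then have "z \<in> set zs" and "w + int n \<le> z"
    using sorted \<open>n > 0\<close> by auto
  then obtain u y where zs: "zs = u @ [y]" and "w + int n \<le> y"
    using sorted by (cases zs rule: rev_cases) (auto simp: sorted_append)
  have "\<not> int n dvd y - w"
    using not_dvd_diff_window[of n "[]" w zs y] permutations_of_setD(2)[OF window] zs by simp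
  then have "y \<noteq> w + int n" by auto
  with \<open>w + int n \<le> y\<close> zs that show ?thesis by simp
qed

text \<open>
  A sorted window that does not fit into \<open>n\<close> consecutive integers has its descent across the
  boundary of the list; rotating makes it visible.
\<close>

lemma window_descent:
  assumes window: "affine_window n ws"
    and nontrivial: "window_class n ws \<noteq> trivial_cyclic_perm n"
  obtains u x y v where "y < x" and "affine_window n (u @ x # y # v)"
    and "window_class n (u @ x # y # v) = window_class n ws"
    and "affine_length (int n) (u @ x # y # v) = affine_length (int n) ws"
proof (cases "sorted ws")
  case False
  with that window show ?thesis by (metis not_sorted_descent)
next
  case True
  have "ws \<noteq> []"
    using window_class_sorted[OF window, of 0] nontrivial by auto
  then obtain w zs where ws: "ws = w # zs" by (cases ws) auto
  with True window nontrivial obtain u y where zs: "zs = u @ [y]" and "w + int n < y"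
    using sorted_window_span by metis
  have rotated: "u @ y # (w + int n) # [] = zs @ [w + int n]" by (simp add: zs)
  show ?thesis
  proof (rule that[OF \<open>w + int n < y\<close>, of u "[]"], unfold rotated ws window_labels_rotate)
    show "rotate1 (window_labels n (w # zs)) \<in> permutations_of_set {1..n}"
      using window by (auto simp: ws permutations_of_set_def)
    show "cyclic_class n (rotate1 (window_labels n (w # zs))) = window_class n (w # zs)"
      using cyclic_class_rotate[OF window, of 1] by (simp add: ws)
    show "affine_length (int n) (zs @ [w + int n]) = affine_length (int n) (w # zs)"
      using window by (intro affine_length_window_rotate) (simp add: ws)
  qed
qed

lemma swap_distance_window_le:
  assumes "affine_window n ws"
  shows "int (swap_distance n (window_class n ws) (trivial_cyclic_perm n))
    \<le> affine_length (int n) ws"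
  using assms
proof (induction "nat (affine_length (int n) ws)" arbitrary: ws rule: less_induct)
  case less
  let ?dist = "\<lambda>ws. swap_distance n (window_class n ws) (trivial_cyclic_perm n)"
  show ?case
  proof (cases "window_class n ws = trivial_cyclic_perm n")
    case True
    then show ?thesis by (simp add: swap_distance_self affine_length_nonneg)
  next
    case False
    with less.prems obtain u x y v where "y < x"
      and window: "affine_window n (u @ x # y # v)"
      and same_class: "window_class n (u @ x # y # v) = window_class n ws"
      and same_length: "affine_length (int n) (u @ x # y # v) = affine_length (int n) ws"
      by (rule window_descent)
    let ?ws' = "u @ y # x # v"
    have window': "affine_window n ?ws'"
      using window by (auto simp: permutations_of_set_def)
    have shorter: "affine_length (int n) ws = affine_length (int n) ?ws' + 1"
      using affine_length_window_swap_descent[OF window \<open>y < x\<close>] same_length by simp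
    then have "nat (affine_length (int n) ?ws') < nat (affine_length (int n) ws)"
      using affine_length_nonneg[of "int n" ?ws'] by linarith
    then have "int (?dist ?ws') \<le> affine_length (int n) ?ws'"
      using window' by (rule less.hyps)
    moreover have "?dist ws \<le> Suc (?dist ?ws')"
    proof (rule swap_distance_le_Suc)
      show "adjacent_swap n (window_class n ws) (window_class n ?ws')"
        using adjacent_swap_append window unfolding same_class[symmetric] by simp
      show "\<exists>k. (adjacent_swap n ^^ k) (window_class n ?ws') (trivial_cyclic_perm n)"
        using window' by (intro trivial_cyclic_perm_reachable cyclic_class_in_cyclic_perms)
    qed
    ultimately show ?thesis using shorter by linarith
  qed
qed

section \<open>Crossings of two labels\<close>

definition residue_rep :: "int \<Rightarrow> int \<Rightarrow> int \<Rightarrow> int" where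
  "residue_rep N b a = b + (a - b) mod N"

lemma residue_rep_mod [simp]: "residue_rep N b a mod N = a mod N"
  by (simp add: residue_rep_def mod_simps)

lemma residue_rep_diff_div:
  assumes "N \<noteq> 0"
  shows "(residue_rep N b' a' - residue_rep N b a) div N =
    (a' - a) div N - ((a' - b') div N - (a - b) div N)"
proof -
  have "residue_rep N b' a' - residue_rep N b a =
      (a' - a) + ((a - b) div N - (a' - b') div N) * N"
    by (simp add: residue_rep_def minus_mult_div_eq_mod[symmetric] algebra_simps)
  then show ?thesis using assms by simp
qed

lemma sum_div_Hermite:
  assumes "n > 0"
  shows "(\<Sum>t<n. (a + int t) div int n) = a"
proof -
  have step: "(\<Sum>t<n. (b + 1 + int t) div int n) = (\<Sum>t<n. (b + int t) div int n) + 1" for b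
  proof -
    have "(\<Sum>t<n. (b + 1 + int t) div int n) - (\<Sum>t<n. (b + int t) div int n) =
        (\<Sum>t<n. (b + int (Suc t)) div int n - (b + int t) div int n)"
      by (simp add: sum_subtractf algebra_simps)
    also have "\<dots> = (b + int n) div int n - b div int n"
      using sum_lessThan_telescope[of "\<lambda>t. (b + int t) div int n" n] by simp
    also have "\<dots> = 1" using assms by simp
    finally show ?thesis by simp
  qed
  show ?thesis
  proof (induction a rule: int_induct[where k = 0])
    case base
    show ?case by simp
  next
    case (step1 b)
    with step[of b] show ?case by simp
  next
    case (step2 b)
    with step[of "b - 1"] show ?case by simp
  qed
qed

lemma div_diff_cases:
  fixes x y N :: int
  assumes "N > 0"
  shows "x div N - y div N = (x - y) div N \<or> x div N - y div N = (x - y) div N + 1"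
proof -
  let ?r = "(x - y) mod N + y mod N"
  have "0 \<le> ?r" and "?r < 2 * N"
    using pos_mod_bound[OF assms, of "x - y"] pos_mod_bound[OF assms, of y]
      pos_mod_sign[OF assms, of "x - y"] pos_mod_sign[OF assms, of y] by linarith+
  then have "?r div N = 0 \<or> ?r div N = 1"
    using assms div_add_self2[of N "?r - N"] by (cases "?r < N") auto
  then show ?thesis using div_add1_eq[of "x - y" y N] by auto
qed

lemma sum_abs_residue_rep_diff_div:
  assumes "n > 0"
  shows "(\<Sum>t<n. \<bar>(residue_rep (int n) (b' - int t) a' -
      residue_rep (int n) (b - int t) a) div int n\<bar>) = \<bar>(b' - b) - (a' - a) mod int n\<bar>"
    (is "(\<Sum>t<n. \<bar>?f t\<bar>) = _")
proof -
  have f: "?f t = (a' - a) div int n -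
      ((a' - b' + int t) div int n - (a - b + int t) div int n)" for t
    using assms by (simp add: residue_rep_diff_div diff_diff_eq2 diff_add_eq)
  let ?c = "(a' - a) div int n - ((a' - b') - (a - b)) div int n"
  have two_values: "?f t = ?c \<or> ?f t = ?c - 1" for t
    using div_diff_cases[of "int n" "a' - b' + int t" "a - b + int t"] assms
    unfolding f by auto
  have same_sign: "(\<forall>t. 0 \<le> ?f t) \<or> (\<forall>t. ?f t \<le> 0)"
  proof (cases "?c \<le> 0")
    case True
    then have "?f t \<le> 0" for t using two_values[of t] by linarith
    then show ?thesis by blast
  next
    case False
    then have "0 \<le> ?f t" for t using two_values[of t] by linarith
    then show ?thesis by blast
  qed
  then have "(\<Sum>t<n. \<bar>?f t\<bar>) = \<bar>\<Sum>t<n. ?f t\<bar>"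
    by (auto simp: sum_nonneg sum_nonpos sum_negf)
  also have "(\<Sum>t<n. ?f t) = int n * ((a' - a) div int n) - ((a' - b') - (a - b))"
    using assms by (simp add: f sum_subtractf sum_div_Hermite)
  also have "\<dots> = (b' - b) - (a' - a) mod int n"
    by (simp add: minus_mult_div_eq_mod[symmetric])
  finally show ?thesis .
qed

section \<open>Averaging over the lifts\<close>

lemma sum_square_symmetric:
  fixes f :: "nat \<Rightarrow> nat \<Rightarrow> 'a::comm_semiring_1"
  assumes "\<And>p q. f p q = f q p"
  shows "(\<Sum>q<n. \<Sum>p<n. f p q) = 2 * (\<Sum>q<n. \<Sum>p<q. f p q) + (\<Sum>q<n. f q q)"
proof (induction n)
  case (Suc n)
  have "(\<Sum>q<n. f n q) = (\<Sum>p<n. f p n)" using assms by simp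
  with Suc show ?case by (simp add: sum.distrib algebra_simps mult_2)
qed simp

lemma bij_betw_diff_mod:
  fixes c N :: int
  assumes "bij_betw x A {0..<N}"
  shows "bij_betw (\<lambda>p. (c - x p) mod N) A {0..<N}"
proof -
  have "bij_betw (\<lambda>a. (c - a) mod N) {0..<N} {0..<N}"
    by (rule bij_betwI[where g = "\<lambda>a. (c - a) mod N"]) (auto simp: mod_simps)
  from bij_betw_trans[OF assms this] show ?thesis by (simp add: comp_def)
qed

lemma bij_betw_int: "bij_betw int {..<n} {0..<int n}"
  by (auto simp: bij_betw_def image_int_atLeastLessThan lessThan_atLeast0)

lemma sum_abs_centered_le: "2 * (\<Sum>d<n. \<bar>2 * int d - int n\<bar>) \<le> (int n)\<^sup>2 + 1"
proof (induction n rule: induct_nat_012)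
  case (ge2 n)
  have "(\<Sum>d<Suc (Suc n). \<bar>2 * int d - int (Suc (Suc n))\<bar>) =
      int n + 2 + (\<Sum>d<Suc n. \<bar>2 * int d - int n\<bar>)"
    unfolding sum.lessThan_Suc_shift[of _ "Suc n"] by (auto intro!: sum.cong)
  also have "\<dots> = (\<Sum>d<n. \<bar>2 * int d - int n\<bar>) + 2 * int n + 2" by simp
  finally show ?case using ge2(1) by (simp add: power2_eq_square algebra_simps)
qed simp_all

lemma abs_centered_mod_uminus:
  fixes a N :: int
  shows "\<bar>2 * ((- a) mod N) - N\<bar> = \<bar>2 * (a mod N) - N\<bar>"
  by (auto simp: zmod_zminus1_eq_if)

lemma sum_pairs_abs_centered_le:
  assumes x: "bij_betw x {..<n} {0..<int n}"
  shows "4 * (\<Sum>q<n. \<Sum>p<q. \<bar>2 * ((x q - x p) mod int n) - int n\<bar>) \<le> int n * (int n - 1)\<^sup>2"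
proof -
  let ?f = "\<lambda>p q. \<bar>2 * ((x q - x p) mod int n) - int n\<bar>"
  let ?S = "\<Sum>d<n. \<bar>2 * int d - int n\<bar>"
  have row: "(\<Sum>p<n. ?f p q) = ?S" for q
    using sum.reindex_bij_betw[OF bij_betw_diff_mod[OF x], of "\<lambda>d. \<bar>2 * d - int n\<bar>" "x q"]
      sum.reindex_bij_betw[OF bij_betw_int, of "\<lambda>d. \<bar>2 * d - int n\<bar>" n] by simp
  have "?f p q = ?f q p" for p q
    using abs_centered_mod_uminus[of "x q - x p" "int n"] by simp
  then have "2 * (\<Sum>q<n. \<Sum>p<q. ?f p q) = int n * ?S - int n * int n"
    using sum_square_symmetric[of ?f n] by (simp add: row)
  then have "4 * (\<Sum>q<n. \<Sum>p<q. ?f p q) = int n * (2 * ?S) - 2 * (int n * int n)" by simp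
  also have "\<dots> \<le> int n * ((int n)\<^sup>2 + 1) - 2 * (int n * int n)"
    using sum_abs_centered_le[of n] by (intro diff_right_mono mult_left_mono) auto
  finally show ?thesis by (simp add: power2_eq_square algebra_simps)
qed

definition shifted_lift :: "nat \<Rightarrow> (nat \<Rightarrow> int) \<Rightarrow> nat \<Rightarrow> int list" where
  "shifted_lift n x t = map (\<lambda>p. residue_rep (int n) (int p - int t) (x p)) [0..<n]"

lemma sum_affine_length_shifted_lift:
  "(\<Sum>t<n. affine_length (int n) (shifted_lift n x t)) =
    (\<Sum>q<n. \<Sum>p<q. \<bar>(int q - int p) - (x q - x p) mod int n\<bar>)"
proof -
  let ?g = "\<lambda>t p q. \<bar>(residue_rep (int n) (int q - int t) (x q)
    - residue_rep (int n) (int p - int t) (x p)) div int n\<bar>"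
  have "(\<Sum>t<n. affine_length (int n) (shifted_lift n x t)) = (\<Sum>q<n. \<Sum>t<n. \<Sum>p<q. ?g t p q)"
    unfolding shifted_lift_def affine_length_map_upt by (rule sum.swap)
  also have "\<dots> = (\<Sum>q<n. \<Sum>p<q. \<Sum>t<n. ?g t p q)"
    by (intro sum.cong refl sum.swap)
  also have "\<dots> = (\<Sum>q<n. \<Sum>p<q. \<bar>(int q - int p) - (x q - x p) mod int n\<bar>)"
    by (intro sum.cong refl sum_abs_residue_rep_diff_div) auto
  finally show ?thesis .
qed

lemma sum_affine_length_shifted_lift_le:
  assumes "bij_betw x {..<n} {0..<int n}"
  shows "4 * (\<Sum>t<n. affine_length (int n) (shifted_lift n x t)) \<le> int n * (int n - 1)\<^sup>2"
proof -
  have pair: "2 * \<bar>(int q - int p) - (x q - x p) mod int n\<bar> \<le>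
      \<bar>2 * ((x q - x p) mod int n) - int n\<bar> + \<bar>2 * ((int q - int p) mod int n) - int n\<bar>"
    if "p < q" "q < n" for p q
  proof -
    have "2 * \<bar>e - d\<bar> \<le> \<bar>2 * d - int n\<bar> + \<bar>2 * e - int n\<bar>" for d e :: int
      by arith
    moreover have "int q - int p = (int q - int p) mod int n" using that by simp
    ultimately show ?thesis by (simp only:)
  qed
  have "8 * (\<Sum>t<n. affine_length (int n) (shifted_lift n x t)) =
      4 * (\<Sum>q<n. \<Sum>p<q. 2 * \<bar>(int q - int p) - (x q - x p) mod int n\<bar>)"
    by (simp add: sum_affine_length_shifted_lift sum_distrib_left)
  also have "\<dots> \<le> 4 * (\<Sum>q<n. \<Sum>p<q. \<bar>2 * ((x q - x p) mod int n) - int n\<bar> +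
      \<bar>2 * ((int q - int p) mod int n) - int n\<bar>)"
    using pair by (intro mult_left_mono sum_mono) auto
  also have "\<dots> \<le> 2 * (int n * (int n - 1)\<^sup>2)"
    using sum_pairs_abs_centered_le[OF assms] sum_pairs_abs_centered_le[OF bij_betw_int, of n]
    by (simp add: sum.distrib)
  finally show ?thesis by simp
qed

lemma exists_short_shifted_lift:
  assumes "bij_betw x {..<n} {0..<int n}" and "n > 0"
  obtains t where "4 * affine_length (int n) (shifted_lift n x t) \<le> (int n - 1)\<^sup>2"
proof (rule ccontr)
  let ?M = "\<lambda>t. 4 * affine_length (int n) (shifted_lift n x t)"
  assume "\<not> thesis"
  with that have "(int n - 1)\<^sup>2 < ?M t" for t by (meson not_le)
  then have "(\<Sum>t<n. (int n - 1)\<^sup>2) < (\<Sum>t<n. ?M t)"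
    using \<open>n > 0\<close> by (intro sum_strict_mono) auto
  with sum_affine_length_shifted_lift_le[OF assms(1)] show False
    by (simp add: sum_distrib_left)
qed

lemma bij_betw_pred_label:
  assumes "xs \<in> permutations_of_set {1..n}"
  shows "bij_betw (\<lambda>p. int (xs ! p) - 1) {..<n} {0..<int n}"
proof -
  have "bij_betw ((!) xs) {..<n} {1..n}"
    using permutations_of_setD[OF assms] length_finite_permutations_of_set[OF assms]
    by (intro bij_betw_nth) auto
  moreover have "bij_betw (\<lambda>l. int l - 1) {1..n} {0..<int n}"
    by (rule bij_betwI[where g = "\<lambda>r. nat (r + 1)"]) auto
  ultimately show ?thesis
    using bij_betw_trans by (fastforce simp: comp_def)
qed

lemma window_labels_shifted_lift:
  assumes "xs \<in> permutations_of_set {1..n}"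
  shows "window_labels n (shifted_lift n (\<lambda>p. int (xs ! p) - 1) t) = xs"
    (is "?labels = _")
proof (rule nth_equalityI)
  have "length ?labels = n" by (simp add: window_labels_def shifted_lift_def)
  then show "length ?labels = length xs"
    using length_finite_permutations_of_set[OF assms] by simp
  fix i assume "i < length ?labels"
  with \<open>length ?labels = n\<close> have "i < n" by simp
  then have "int (xs ! i) - 1 \<in> {0..<int n}"
    using bij_betw_pred_label[OF assms] by (auto dest: bij_betwE)
  then show "?labels ! i = xs ! i"
    using \<open>i < n\<close> by (simp add: window_labels_def shifted_lift_def nat_diff_distrib')
qed

lemma swap_distance_trivial_le:
  assumes "\<pi> \<in> cyclic_perms n" and "n > 0"
  shows "4 * int (swap_distance n \<pi> (trivial_cyclic_perm n)) \<le> (int n - 1)\<^sup>2"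
proof -
  from assms(1) obtain xs where xs: "xs \<in> permutations_of_set {1..n}" and \<pi>: "\<pi> = cyclic_class n xs"
    by (auto simp: cyclic_perms_def cyclic_class_def elim!: quotientE)
  let ?lift = "shifted_lift n (\<lambda>p. int (xs ! p) - 1)"
  obtain t where "4 * affine_length (int n) (?lift t) \<le> (int n - 1)\<^sup>2"
    using exists_short_shifted_lift[OF bij_betw_pred_label[OF xs] assms(2)] .
  moreover have "int (swap_distance n \<pi> (trivial_cyclic_perm n)) \<le> affine_length (int n) (?lift t)"
    using swap_distance_window_le[of n "?lift t"] window_labels_shifted_lift[OF xs] xs \<pi> by simp
  ultimately show ?thesis by linarith
qed

theorem theorem2p1:
  fixes n :: nat
  assumes "n \<ge> 1"
  shows "int (max_swap_distance n) \<le> \<lfloor>(real n - 1)\<^sup>2 / 4\<rfloor>"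
proof -
  have "max_swap_distance n \<in> (\<lambda>\<pi>. swap_distance n \<pi> (trivial_cyclic_perm n)) ` cyclic_perms n"
    unfolding max_swap_distance_def
    using finite_cyclic_perms trivial_cyclic_perm_in_cyclic_perms by (intro Max_in) auto
  then have "4 * int (max_swap_distance n) \<le> (int n - 1)\<^sup>2"
    using swap_distance_trivial_le assms by auto
  then have "real_of_int (4 * int (max_swap_distance n)) \<le> real_of_int ((int n - 1)\<^sup>2)"
    by (simp only: of_int_le_iff)
  then show ?thesis by (simp add: le_floor_iff)
qed

end
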